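(* Let $\vartheta\in\mathcal{G}(\mathbb{R}^d)$ be a Gaussian distribution with parameters $(\mu,\Sigma)$. Let $\lambda_1,\dots,\lambda_k$ be the eigenvalues of $\Sigma$ with multiplicities $m_1,\dots,m_k$. If we write $\mu=(\mu_1,\dots,\mu_k)$ where $\mu_j\in\mathbb{R}^{m_j}$, the stabilizer of $\vartheta$ (under the action of $O(d)$) is in bijection with $$\prod_{j=1}^k O\big(m_j-\mathbb{1}_{\{\mu_j\neq0\}}\big).$$ If all eigenvalues are different, the stabilizer is in bijection with $(\mathbb{Z}_2)^{|\{j\,:\,\mu_j=0\}|}$.
   Context: $\mathcal{G}(\mathbb{R}^d)$ is the set of (possibly degenerate) Gaussian distributions $\mathcal{N}(\mu,\Sigma)$ on $\mathbb{R}^d$, identified with the set of pairs $(\mu,\Sigma)$ where $\mu\in\mathbb{R}^d$ and $\Sigma$ is a symmetric positive semidefinite $d\times d$ real matrix. The orthogonal group $O(d)$ acts on $\mathcal{G}(\mathbb{R}^d)$ by pushforward: $Q\cdot\mathcal{N}(\mu,\Sigma)=\mathcal{N}(Q\mu,Q\Sigma Q^\top)$. The stabilizer of $\vartheta$ is $\{Q\in O(d) : Q\cdot\vartheta=\vartheta\}$. Here $\mathbb{1}_{\{\mu_j\ne0\}}$ equals $1$ if $\mu_j\neq0$ and $0$ otherwise, and $O(0)$ is the trivial group. *)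

theory Defs
  imports
    "Jordan_Normal_Form.Char_Poly"
    "HOL-Algebra.Group_Action"
    "HOL-Algebra.Product_Groups"
    "HOL-Algebra.Elementary_Groups"
begin

text \<open>A Gaussian distribution \<open>N(\<mu>, \<Sigma>)\<close> on \<open>\<real>\<^sup>d\<close>, possibly degenerate, is identified with its
  pair of parameters.\<close>

definition gaussians :: "nat \<Rightarrow> (real vec \<times> real mat) set" where
  "gaussians d = {(\<mu>, \<Sigma>). \<mu> \<in> carrier_vec d \<and> \<Sigma> \<in> carrier_mat d d \<and> transpose_mat \<Sigma> = \<Sigma> \<and>
     (\<forall>x \<in> carrier_vec d. 0 \<le> x \<bullet> (\<Sigma> *\<^sub>v x))}"

text \<open>For \<open>n = 0\<close> the carrier is the singleton consisting of the empty matrix.\<close>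

definition orthogonal_group :: "nat \<Rightarrow> real mat monoid" where
  "orthogonal_group n =
     \<lparr>carrier = {Q \<in> carrier_mat n n. transpose_mat Q * Q = 1\<^sub>m n \<and> Q * transpose_mat Q = 1\<^sub>m n},
      monoid.mult = (*), one = 1\<^sub>m n\<rparr>"

definition gaussian_action :: "real mat \<Rightarrow> real vec \<times> real mat \<Rightarrow> real vec \<times> real mat" where
  "gaussian_action Q = (\<lambda>(\<mu>, \<Sigma>). (Q *\<^sub>v \<mu>, Q * \<Sigma> * transpose_mat Q))"

definition block_vec :: "nat \<Rightarrow> (nat \<Rightarrow> 'a vec) \<Rightarrow> 'a vec" where
  "block_vec k v = vec_of_list (concat (map (\<lambda>j. list_of_vec (v j)) [0..<k]))"

text \<open>Writing \<open>\<mu> = (\<mu>\<^sub>1, \<dots>, \<mu>\<^sub>k)\<close> with \<open>\<mu>\<^sub>j \<in> \<real>\<^bsup>m\<^sub>j\<^esup>\<close> refers to coordinates in an orthonormal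
  eigenbasis of \<open>\<Sigma>\<close>, here the columns of \<open>U\<close>, grouped by eigenvalue: \<open>\<Sigma>\<close> becomes
  \<open>diag (\<lambda>\<^sub>1 I, \<dots>, \<lambda>\<^sub>k I)\<close> and \<open>\<mu>\<close> becomes the concatenation of the blocks \<open>\<mu>\<^sub>j\<close>. Indices run
  over \<open>0, \<dots>, k - 1\<close>.\<close>

definition eigen_coordinates ::
  "nat \<Rightarrow> nat \<Rightarrow> (nat \<Rightarrow> real) \<Rightarrow> (nat \<Rightarrow> nat) \<Rightarrow> real vec \<times> real mat \<Rightarrow>
    real mat \<Rightarrow> (nat \<Rightarrow> real vec) \<Rightarrow> bool" where
  "eigen_coordinates d k eig m = (\<lambda>(\<mu>, \<Sigma>) U \<mu>s.
     U \<in> carrier (orthogonal_group d) \<and>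
     \<Sigma> = U * diag_block_mat (map (\<lambda>j. eig j \<cdot>\<^sub>m 1\<^sub>m (m j)) [0..<k]) * transpose_mat U \<and>
     (\<forall>j<k. \<mu>s j \<in> carrier_vec (m j)) \<and>
     \<mu> = U *\<^sub>v block_vec k \<mu>s)"

end

theory Submission
  imports Defs "HOL-Library.Equipollence"
begin

text \<open>An orthogonal matrix fixes \<open>\<Sigma>\<close> under conjugation iff it commutes with \<open>\<Sigma>\<close>. In an
  orthonormal eigenbasis it then commutes with \<open>diag (\<lambda>\<^sub>1 I, \<dots>, \<lambda>\<^sub>k I)\<close>, and since the
  \<open>\<lambda>\<^sub>j\<close> are distinct it is block diagonal, one orthogonal block per eigenvalue; it fixes \<open>\<mu>\<close> iff the
  \<open>j\<close>-th block fixes \<open>\<mu>\<^sub>j\<close>. When \<open>\<mu>\<^sub>j \<noteq> 0\<close>, a Householder reflection moves \<open>\<mu>\<^sub>j\<close> onto the first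
  coordinate axis, whose stabilizer in \<open>O(m\<^sub>j)\<close> is a copy of \<open>O(m\<^sub>j - 1)\<close>. The eigenbasis itself comes
  from the same reflections, splitting off one eigenvector at a time.\<close>

section \<open>Direct sums and orthogonal matrices\<close>

text \<open>The two-block case of \<open>diag_block_mat\<close>. Longer block diagonal matrices are
  treated by splitting off one block at a time.\<close>

definition direct_sum :: "'a :: zero mat \<Rightarrow> 'a mat \<Rightarrow> 'a mat" where
  "direct_sum A B = four_block_mat A (0\<^sub>m (dim_row A) (dim_col B)) (0\<^sub>m (dim_row B) (dim_col A)) B"

lemma direct_sum_carrier [simp]:
  "A \<in> carrier_mat n n \<Longrightarrow> B \<in> carrier_mat m m \<Longrightarrow> direct_sum A B \<in> carrier_mat (n + m) (n + m)"
  by (simp add: direct_sum_def)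

lemma transpose_direct_sum: "transpose_mat (direct_sum A B) = direct_sum (transpose_mat A) (transpose_mat B)"
  unfolding direct_sum_def
  by (subst transpose_four_block_mat) (auto intro: carrier_matI)

lemma direct_sum_mult:
  fixes A A' B B' :: "'a :: semiring_0 mat"
  assumes "A \<in> carrier_mat n n" "A' \<in> carrier_mat n n" "B \<in> carrier_mat m m" "B' \<in> carrier_mat m m"
  shows "direct_sum A B * direct_sum A' B' = direct_sum (A * A') (B * B')"
  unfolding direct_sum_def
  by (subst mult_four_block_mat) (use assms in auto)

lemma direct_sum_mult_vec:
  fixes A B :: "'a :: semiring_0 mat"
  assumes "A \<in> carrier_mat n n" "B \<in> carrier_mat m m" "v \<in> carrier_vec n" "w \<in> carrier_vec m"
  shows "direct_sum A B *\<^sub>v (v @\<^sub>v w) = (A *\<^sub>v v) @\<^sub>v (B *\<^sub>v w)"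
  using assms by (auto simp: direct_sum_def mult_mat_vec_split)

lemma direct_sum_one [simp]: "direct_sum (1\<^sub>m n) (1\<^sub>m m) = 1\<^sub>m (n + m)"
  by (simp add: direct_sum_def)

text \<open>Shifting row or column indices by \<open>n\<close> reads each block off the whole
  matrix, so a matrix equation may be compared block by block.\<close>

lemma four_block_eq_iff:
  assumes "A \<in> carrier_mat n n" "B \<in> carrier_mat n m" "C \<in> carrier_mat m n" "E \<in> carrier_mat m m"
    and "A' \<in> carrier_mat n n" "B' \<in> carrier_mat n m" "C' \<in> carrier_mat m n" "E' \<in> carrier_mat m m"
  shows "four_block_mat A B C E = four_block_mat A' B' C' E' \<longleftrightarrow> A = A' \<and> B = B' \<and> C = C' \<and> E = E'"
proof
  assume eq: "four_block_mat A B C E = four_block_mat A' B' C' E'"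
  have *: "four_block_mat A B C E $$ (i, j) = four_block_mat A' B' C' E' $$ (i, j)" for i j
    by (simp add: eq)
  have "A $$ (i, j) = A' $$ (i, j)" if "i < n" "j < n" for i j
    using *[of i j] that assms by simp
  moreover have "B $$ (i, j) = B' $$ (i, j)" if "i < n" "j < m" for i j
    using *[of i "n + j"] that assms by simp
  moreover have "C $$ (i, j) = C' $$ (i, j)" if "i < m" "j < n" for i j
    using *[of "n + i" j] that assms by simp
  moreover have "E $$ (i, j) = E' $$ (i, j)" if "i < m" "j < m" for i j
    using *[of "n + i" "n + j"] that assms by simp
  ultimately show "A = A' \<and> B = B' \<and> C = C' \<and> E = E'"
    using assms by (intro conjI eq_matI) auto
qed auto

lemma direct_sum_eq_iff:
  assumes "A \<in> carrier_mat n n" "A' \<in> carrier_mat n n" "B \<in> carrier_mat m m" "B' \<in> carrier_mat m m"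
  shows "direct_sum A B = direct_sum A' B' \<longleftrightarrow> A = A' \<and> B = B'"
  unfolding direct_sum_def by (subst four_block_eq_iff) (use assms in auto)

section \<open>Closure and cancellation in the orthogonal group\<close>

lemma orthogonal_group_iff:
  "Q \<in> carrier (orthogonal_group n) \<longleftrightarrow>
     Q \<in> carrier_mat n n \<and> transpose_mat Q * Q = 1\<^sub>m n \<and> Q * transpose_mat Q = 1\<^sub>m n"
  by (simp add: orthogonal_group_def)

lemma orthogonal_group_mult:
  assumes "P \<in> carrier (orthogonal_group n)" "Q \<in> carrier (orthogonal_group n)"
  shows "P * Q \<in> carrier (orthogonal_group n)"
proof -
  have c: "P \<in> carrier_mat n n" "Q \<in> carrier_mat n n"
    and P: "transpose_mat P * P = 1\<^sub>m n" and Q: "transpose_mat Q * Q = 1\<^sub>m n"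
    using assms by (auto simp: orthogonal_group_iff)
  have "transpose_mat (P * Q) * (P * Q) = transpose_mat Q * (transpose_mat P * P) * Q"
    using c by (simp add: transpose_mult[OF c] assoc_mult_mat[of _ n n _ n _ n])
  then have 1: "transpose_mat (P * Q) * (P * Q) = 1\<^sub>m n"
    using c P Q by simp
  have 2: "P * Q \<in> carrier_mat n n" "transpose_mat (P * Q) \<in> carrier_mat n n"
    using c by auto
  show ?thesis
    using 1 2 mat_mult_left_right_inverse[OF 2(2,1) 1] by (simp only: orthogonal_group_iff simp_thms)
qed

lemma orthogonal_group_transpose:
  "Q \<in> carrier (orthogonal_group n) \<Longrightarrow> transpose_mat Q \<in> carrier (orthogonal_group n)"
  by (simp add: orthogonal_group_iff)

lemma orthogonal_group_one [simp]: "1\<^sub>m n \<in> carrier (orthogonal_group n)"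
  by (simp add: orthogonal_group_iff)

lemma orthogonal_group_cancel:
  assumes "P \<in> carrier (orthogonal_group n)" "A \<in> carrier_mat n m"
  shows "transpose_mat P * (P * A) = A" "P * (transpose_mat P * A) = A"
  using assms by (auto simp: orthogonal_group_iff simp flip: assoc_mult_mat[of _ n n _ n _ m])

lemma orthogonal_group_cancel_vec:
  assumes "P \<in> carrier (orthogonal_group n)" "v \<in> carrier_vec n"
  shows "transpose_mat P *\<^sub>v (P *\<^sub>v v) = v" "P *\<^sub>v (transpose_mat P *\<^sub>v v) = v"
  using assms by (auto simp: orthogonal_group_iff simp flip: assoc_mult_mat_vec[of _ n n _ n _])

text \<open>Transposition and multiplication act blockwise. Once the identity is itself written as a
  direct sum, both orthogonality equations split into their blocks.\<close>

lemma direct_sum_orthogonal_iff: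
  assumes "A \<in> carrier_mat n n" "B \<in> carrier_mat m m"
  shows "direct_sum A B \<in> carrier (orthogonal_group (n + m)) \<longleftrightarrow>
    A \<in> carrier (orthogonal_group n) \<and> B \<in> carrier (orthogonal_group m)"
  using assms
  by (auto simp: orthogonal_group_iff transpose_direct_sum direct_sum_mult[where n = n and m = m]
      direct_sum_eq_iff[where n = n and m = m] simp flip: direct_sum_one)

section \<open>Householder reflections\<close>

lemma scalar_prod_self_ge_0: "0 \<le> (v :: real vec) \<bullet> v"
  by (simp add: scalar_prod_def sum_nonneg)

lemma scalar_prod_self_eq_0_iff:
  fixes v :: "real vec"
  assumes "v \<in> carrier_vec n"
  shows "v \<bullet> v = 0 \<longleftrightarrow> v = 0\<^sub>v n"
  using assms by (auto simp: scalar_prod_def sum_nonneg_eq_0_iff)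

text \<open>The vector \<open>v\<close> and the axis vector scaled by the norm of \<open>v\<close>
  have equal length, so the reflection in the hyperplane orthogonal to their difference exchanges
  them. If they coincide, the identity matrix serves.\<close>

lemma orthogonal_moves_axis_to:
  fixes v :: "real vec"
  assumes v: "v \<in> carrier_vec (Suc n)"
  obtains W where "W \<in> carrier (orthogonal_group (Suc n))"
    and "W *\<^sub>v (sqrt (v \<bullet> v) \<cdot>\<^sub>v unit_vec (Suc n) 0) = v"
proof -
  define c where "c = sqrt (v \<bullet> v)"
  define u where "u = c \<cdot>\<^sub>v unit_vec (Suc n) 0"
  define w where "w = v - u"
  \<comment> \<open>With this factor, the identity minus \<open>s\<close> times the outer product of
    \<open>w\<close> with itself is the reflection along \<open>w\<close>. The case
    \<open>w = 0\<close>, where the quotient degenerates, is treated separately.\<close>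
  define s where "s = 2 / (w \<bullet> w)"
  \<comment> \<open>the reflection swapping \<open>u\<close> and \<open>v\<close>\<close>
  define W where "W = mat (Suc n) (Suc n) (\<lambda>(i, j). (if i = j then 1 else 0) - s * (w $ i * w $ j))"
  have c2: "c * c = v \<bullet> v"
    unfolding c_def using scalar_prod_self_ge_0[of v] by simp
  have wc: "w \<in> carrier_vec (Suc n)" and uc: "u \<in> carrier_vec (Suc n)"
    using v by (auto simp: w_def u_def)
  show thesis
  proof (cases "w = 0\<^sub>v (Suc n)")
    case True
    then have "(v - u) $ i = 0" if "i < Suc n" for i
      using that unfolding w_def by simp
    then have "v = u"
      using v uc by (intro eq_vecI) auto
    then show thesis
      using uc that[of "1\<^sub>m (Suc n)"] by (simp add: u_def c_def)
  next
    case False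
    then have w0: "w \<bullet> w \<noteq> 0"
      using wc by (simp add: scalar_prod_self_eq_0_iff)
    have uu: "u \<bullet> u = v \<bullet> v"
      using c2 by (simp add: u_def)
    \<comment> \<open>Equal lengths of \<open>u\<close> and \<open>v\<close> enter here. The
      consequence \<open>s * (w \<bullet> u) = - 1\<close> makes the reflection send
      \<open>u\<close> to \<open>u + w\<close>, which is \<open>v\<close>.\<close>
    have ww: "w \<bullet> w = - 2 * (w \<bullet> u)"
      using v uc uu comm_scalar_prod[OF v uc]
      by (simp add: w_def minus_scalar_prod_distrib[of _ "Suc n"] scalar_prod_minus_distrib[of _ "Suc n"])
    have sum: "(\<Sum>l<Suc n. w $ l * w $ l) = w \<bullet> w" "(\<Sum>l<Suc n. w $ l * u $ l) = w \<bullet> u"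
      using wc uc by (simp_all add: scalar_prod_def atLeast0LessThan)
    have s: "s * (w \<bullet> w) = 2"
      using w0 by (simp add: s_def)
    then have su: "s * (w \<bullet> u) = - 1"
      unfolding ww by simp
    have Wc: "W \<in> carrier_mat (Suc n) (Suc n)" and Wt: "transpose_mat W = W"
      by (auto simp: W_def intro!: eq_matI)
    have "W * W = 1\<^sub>m (Suc n)"
    proof (rule eq_matI)
      fix i j assume ij: "i < dim_row (1\<^sub>m (Suc n))" "j < dim_col (1\<^sub>m (Suc n))"
      \<comment> \<open>The product of two entries is expanded into Kronecker deltas and one
        quadratic term. The quadratic term sums to a multiple of \<open>w \<bullet> w\<close> and
        cancels the mixed terms because \<open>s * (w \<bullet> w) = 2\<close>.\<close>
      have "(W * W) $$ (i, j) = (\<Sum>l<Suc n. W $$ (i, l) * W $$ (l, j))"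
        using ij Wc by (simp add: scalar_prod_def atLeast0LessThan)
      also have "\<dots> = (\<Sum>l<Suc n. (if l = i then (if i = j then 1 else 0) - s * (w $ i * w $ j) else 0)
          - (if l = j then s * (w $ i * w $ j) else 0) + s * s * w $ i * w $ j * (w $ l * w $ l))"
        using ij by (intro sum.cong refl) (auto simp: W_def algebra_simps)
      also have "\<dots> = (if i = j then 1 else 0) - 2 * s * (w $ i * w $ j) + s * s * w $ i * w $ j * (w \<bullet> w)"
        using ij unfolding sum.distrib sum_subtractf sum_distrib_left[symmetric] sum
        by (simp add: sum.delta)
      also have "s * s * w $ i * w $ j * (w \<bullet> w) = 2 * s * (w $ i * w $ j)"
      proof -
        have "s * s * w $ i * w $ j * (w \<bullet> w) = (s * (w \<bullet> w)) * (s * (w $ i * w $ j))"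
          by (simp only: ac_simps)
        then show ?thesis
          by (simp add: s)
      qed
      finally have "(W * W) $$ (i, j) = (if i = j then 1 else 0)"
        by simp
      then show "(W * W) $$ (i, j) = 1\<^sub>m (Suc n) $$ (i, j)"
        using ij by simp
    qed (use Wc in auto)
    then have "W \<in> carrier (orthogonal_group (Suc n))"
      using Wc Wt by (simp add: orthogonal_group_iff)
    moreover have "W *\<^sub>v u = v"
    proof (rule eq_vecI)
      fix i assume i: "i < dim_vec v"
      have "(W *\<^sub>v u) $ i = (\<Sum>l<Suc n. W $$ (i, l) * u $ l)"
        using i v uc Wc by (simp add: scalar_prod_def atLeast0LessThan)
      also have "\<dots> = (\<Sum>l<Suc n. (if l = i then u $ i else 0) - s * w $ i * (w $ l * u $ l))"
        using i v by (intro sum.cong refl) (auto simp: W_def algebra_simps)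
      also have "\<dots> = u $ i - s * w $ i * (w \<bullet> u)"
        using i v unfolding sum_subtractf sum_distrib_left[symmetric] sum by (simp add: sum.delta)
      also have "s * w $ i * (w \<bullet> u) = w $ i * (s * (w \<bullet> u))"
        by simp
      also have "\<dots> = - w $ i"
        using su by simp
      also have "u $ i - - w $ i = v $ i"
        using i v uc by (simp add: w_def)
      finally show "(W *\<^sub>v u) $ i = v $ i" .
    qed (use Wc v in auto)
    ultimately show thesis
      using that by (simp add: u_def c_def)
  qed
qed

text \<open>The hypothesis on \<open>A\<close> clears the first column below the corner, the one on
  the transpose clears the first row. For symmetric matrices, and for orthogonal ones with
  \<open>c = 1\<close>, the second follows from the first.\<close>

lemma fixed_axis_block:
  fixes A :: "'a :: comm_ring_1 mat"
  assumes A: "A \<in> carrier_mat (Suc n) (Suc n)"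
    and col: "A *\<^sub>v unit_vec (Suc n) 0 = c \<cdot>\<^sub>v unit_vec (Suc n) 0"
    and row: "transpose_mat A *\<^sub>v unit_vec (Suc n) 0 = c \<cdot>\<^sub>v unit_vec (Suc n) 0"
  obtains E where "E \<in> carrier_mat n n" "A = direct_sum (c \<cdot>\<^sub>m 1\<^sub>m 1) E"
proof
  define E where "E = mat n n (\<lambda>(i, j). A $$ (Suc i, Suc j))"
  show "E \<in> carrier_mat n n"
    by (simp add: E_def)
  have c0: "A $$ (i, 0) = (if i = 0 then c else 0)" if "i < Suc n" for i
    using arg_cong[OF col, of "\<lambda>v. v $ i"] that A by auto
  have r0: "A $$ (0, i) = (if i = 0 then c else 0)" if "i < Suc n" for i
    using arg_cong[OF row, of "\<lambda>v. v $ i"] that A by auto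
  show "A = direct_sum (c \<cdot>\<^sub>m 1\<^sub>m 1) E"
  proof (rule eq_matI)
    fix i j assume "i < dim_row (direct_sum (c \<cdot>\<^sub>m 1\<^sub>m 1) E)" "j < dim_col (direct_sum (c \<cdot>\<^sub>m 1\<^sub>m 1) E)"
    then have "i < Suc n" "j < Suc n"
      by (auto simp: direct_sum_def E_def)
    then show "A $$ (i, j) = direct_sum (c \<cdot>\<^sub>m 1\<^sub>m 1) E $$ (i, j)"
      by (cases i; cases j) (auto simp: direct_sum_def E_def c0 r0)
  qed (use A in \<open>auto simp: direct_sum_def E_def\<close>)
qed

section \<open>The spectral theorem for real symmetric matrices\<close>

lemma symmetric_eigenvalue_real:
  fixes A :: "real mat"
  assumes A: "A \<in> carrier_mat n n" and sym: "transpose_mat A = A"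
    and ev: "eigenvalue (map_mat complex_of_real A) z"
  shows "Im z = 0"
proof -
  obtain x where x: "x \<in> carrier_vec n" "x \<noteq> 0\<^sub>v n"
    and Ax: "map_mat complex_of_real A *\<^sub>v x = z \<cdot>\<^sub>v x"
    using ev A by (auto simp: eigenvalue_def eigenvector_def)
  \<comment> \<open>Compare \<open>A q \<bullet> p\<close> with \<open>q \<bullet> A p\<close> for the real and imaginary parts of the eigenvector.\<close>
  define p q where "p = map_vec Re x" and "q = map_vec Im x"
  have pq: "p \<in> carrier_vec n" "q \<in> carrier_vec n"
    using x by (auto simp: p_def q_def)
  have entry: "(\<Sum>l<n. complex_of_real (A $$ (i, l)) * x $ l) = z * x $ i" if "i < n" for i
    using arg_cong[OF Ax, of "\<lambda>v. v $ i"] that A x by (simp add: scalar_prod_def atLeast0LessThan)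
  have Ap: "A *\<^sub>v p = Re z \<cdot>\<^sub>v p - Im z \<cdot>\<^sub>v q"
  proof (rule eq_vecI)
    fix i assume "i < dim_vec (Re z \<cdot>\<^sub>v p - Im z \<cdot>\<^sub>v q)"
    then have "i < n" using pq by simp
    then show "(A *\<^sub>v p) $ i = (Re z \<cdot>\<^sub>v p - Im z \<cdot>\<^sub>v q) $ i"
      using arg_cong[OF entry, of i Re] A x
      by (simp add: p_def q_def scalar_prod_def atLeast0LessThan)
  qed (use A pq in auto)
  have Aq: "A *\<^sub>v q = Re z \<cdot>\<^sub>v q + Im z \<cdot>\<^sub>v p"
  proof (rule eq_vecI)
    fix i assume "i < dim_vec (Re z \<cdot>\<^sub>v q + Im z \<cdot>\<^sub>v p)"
    then have "i < n" using pq by simp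
    then show "(A *\<^sub>v q) $ i = (Re z \<cdot>\<^sub>v q + Im z \<cdot>\<^sub>v p) $ i"
      using arg_cong[OF entry, of i Im] A x
      by (simp add: p_def q_def scalar_prod_def atLeast0LessThan)
  qed (use A pq in auto)
  have "(A *\<^sub>v q) \<bullet> p = q \<bullet> (A *\<^sub>v p)"
    using transpose_vec_mult_scalar[OF A pq] by (simp add: sym)
  also have "\<dots> = Re z * (q \<bullet> p) - Im z * (q \<bullet> q)"
    unfolding Ap using pq by (simp add: scalar_prod_minus_distrib[of _ n])
  \<comment> \<open>Expanding the left side by the formula for \<open>A q\<close> makes the terms
    with \<open>Re z\<close> cancel. The remaining factor is the squared length of the eigenvector,
    which is nonzero.\<close>
  finally have "Im z * (p \<bullet> p + q \<bullet> q) = 0"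
    unfolding Aq using pq by (simp add: add_scalar_prod_distrib[of _ n] algebra_simps)
  moreover have "p \<bullet> p + q \<bullet> q \<noteq> 0"
  proof
    assume "p \<bullet> p + q \<bullet> q = 0"
    then have "p \<bullet> p = 0" "q \<bullet> q = 0"
      using scalar_prod_self_ge_0[of p] scalar_prod_self_ge_0[of q] by linarith+
    then have "p = 0\<^sub>v n" "q = 0\<^sub>v n"
      using pq by (auto simp: scalar_prod_self_eq_0_iff)
    then have "p $ i = 0" "q $ i = 0" if "i < n" for i
      using that by simp_all
    then have "Re (x $ i) = 0" "Im (x $ i) = 0" if "i < n" for i
      using that x by (auto simp: p_def q_def)
    then have "x = 0\<^sub>v n"
      using x by (intro eq_vecI) (auto simp: complex_eq_iff)
    then show False
      using x by simp
  qed
  ultimately show ?thesis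
    by simp
qed

lemma map_poly_linear_factors:
  "map_poly complex_of_real (\<Prod>a\<leftarrow>es. [:- a, 1:]) = (\<Prod>a\<leftarrow>map complex_of_real es. [:- a, 1:])"
proof -
  interpret map_poly_inj_idom_hom complex_of_real ..
  show ?thesis
    by (induction es) (simp_all add: hom_distribs del: mult_pCons_left)
qed

text \<open>Over the complex numbers the polynomial splits, and its roots are eigenvalues, hence
  real. The factorization descends to the reals because the embedding of real polynomials into
  complex ones is injective.\<close>

lemma symmetric_char_poly_splits:
  fixes A :: "real mat"
  assumes A: "A \<in> carrier_mat n n" and sym: "transpose_mat A = A"
  obtains es where "char_poly A = (\<Prod>a\<leftarrow>es. [:- a, 1:])"
proof -
  interpret map_poly_inj_idom_hom complex_of_real ..
  define C where "C = map_mat complex_of_real A"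
  have C: "C \<in> carrier_mat n n"
    using A by (simp add: C_def)
  obtain zs where zs: "char_poly C = (\<Prod>a\<leftarrow>zs. [:- a, 1:])"
    using char_poly_factorized[OF C] by blast
  have "Im z = 0" if "z \<in> set zs" for z
  proof (rule symmetric_eigenvalue_real[OF A sym])
    have "poly (char_poly C) z = 0"
      unfolding zs poly_prod_list using that by (auto simp: prod_list_zero_iff)
    then show "eigenvalue (map_mat complex_of_real A) z"
      using eigenvalue_root_char_poly[OF C] by (simp add: C_def)
  qed
  then have "zs = map complex_of_real (map Re zs)"
    by (induction zs) (auto simp: complex_eq_iff)
  then have "map_poly complex_of_real (char_poly A) = (\<Prod>a\<leftarrow>map complex_of_real (map Re zs). [:- a, 1:])"
    using zs of_real_hom.char_poly_hom[OF A, where 'a = complex] by (simp add: C_def)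
  also have "\<dots> = map_poly complex_of_real (\<Prod>a\<leftarrow>map Re zs. [:- a, 1:])"
    by (rule map_poly_linear_factors[symmetric])
  finally have "char_poly A = (\<Prod>a\<leftarrow>map Re zs. [:- a, 1:])"
    by (rule injectivity)
  then show thesis
    by (rule that)
qed

section \<open>Orthogonal diagonalization\<close>

lemma mat_diag_append:
  "mat_diag (length (xs @ ys)) ((!) (xs @ ys)) =
    direct_sum (mat_diag (length xs) ((!) xs)) (mat_diag (length ys) ((!) ys))"
  by (rule eq_matI) (auto simp: mat_diag_def direct_sum_def nth_append)

lemma conjugate_conjugate:
  fixes P Q A :: "'a :: comm_semiring_0 mat"
  assumes P: "P \<in> carrier_mat n n" and Q: "Q \<in> carrier_mat n n" and A: "A \<in> carrier_mat n n"
  shows "P * (Q * A * transpose_mat Q) * transpose_mat P = P * Q * A * transpose_mat (P * Q)"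
proof -
  have c: "Q * A \<in> carrier_mat n n" "P * (Q * A) \<in> carrier_mat n n"
    "transpose_mat P \<in> carrier_mat n n" "transpose_mat Q \<in> carrier_mat n n"
    using assms by auto
  have "P * (Q * A * transpose_mat Q) = P * Q * A * transpose_mat Q"
    by (simp only: assoc_mult_mat[OF P c(1,4), symmetric] assoc_mult_mat[OF P Q A])
  moreover have "P * Q * A * transpose_mat Q * transpose_mat P = P * Q * A * transpose_mat (P * Q)"
    unfolding transpose_mult[OF P Q] by (rule assoc_mult_mat[of _ n n _ n _ n]) (use assms in auto)
  ultimately show ?thesis
    by simp
qed

text \<open>Induction on the dimension: an eigenvector for the head of \<open>es\<close> is rotated
  onto the first axis, symmetry splits off a one-dimensional block, and the tail of
  \<open>es\<close> describes the rest. The list fixes the order of the diagonal, so eigenvalues can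
  later be grouped as desired.\<close>

lemma symmetric_orthogonal_diagonalization:
  fixes A :: "real mat"
  assumes "A \<in> carrier_mat n n" "transpose_mat A = A"
    and "char_poly A = (\<Prod>a\<leftarrow>es. [:- a, 1:])"
  shows "\<exists>U \<in> carrier (orthogonal_group n). A = U * mat_diag n ((!) es) * transpose_mat U"
  using assms
proof (induction n arbitrary: A es)
  case 0
  then show ?case
    by (intro bexI[of _ "1\<^sub>m 0"]) (auto intro!: eq_matI)
next
  case (Suc n)
  note A = Suc.prems(1) and sym = Suc.prems(2) and cp = Suc.prems(3)
  have len: "length es = Suc n"
    using degree_monic_char_poly[OF A] degree_linear_factors[of uminus es] by (simp add: cp)
  then obtain e fs where es: "es = e # fs" and fs: "length fs = n"
    by (cases es) auto
  have "poly (char_poly A) e = 0"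
    by (simp add: cp es)
  then have "eigenvalue A e"
    using eigenvalue_root_char_poly[OF A] by blast
  then obtain v where v: "v \<in> carrier_vec (Suc n)" "v \<noteq> 0\<^sub>v (Suc n)" and Av: "A *\<^sub>v v = e \<cdot>\<^sub>v v"
    using A by (auto simp: eigenvalue_def eigenvector_def)
  define r where "r = sqrt (v \<bullet> v)"
  define x :: "real vec" where "x = unit_vec (Suc n) 0"
  have xc: "x \<in> carrier_vec (Suc n)"
    by (simp add: x_def)
  have r: "r \<noteq> 0"
    using v by (simp add: r_def scalar_prod_self_eq_0_iff)
  obtain W where W: "W \<in> carrier (orthogonal_group (Suc n))" and Wv: "W *\<^sub>v (r \<cdot>\<^sub>v x) = v"
    using orthogonal_moves_axis_to[OF v(1)] unfolding r_def x_def by blast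
  have Wc: "W \<in> carrier_mat (Suc n) (Suc n)"
    using W by (simp add: orthogonal_group_iff)
  have "r \<cdot>\<^sub>v (A *\<^sub>v (W *\<^sub>v x)) = r \<cdot>\<^sub>v (e \<cdot>\<^sub>v (W *\<^sub>v x))"
    using Av A Wc xc unfolding Wv[symmetric]
    by (simp add: mult_mat_vec[of _ "Suc n" "Suc n"] smult_smult_assoc mult.commute)
  then have AWx: "A *\<^sub>v (W *\<^sub>v x) = e \<cdot>\<^sub>v (W *\<^sub>v x)"
    using r by (auto simp: vec_eq_iff)
  \<comment> \<open>In the new coordinates the first axis is an eigenvector of \<open>M\<close>.
    Since \<open>M\<close> is symmetric, its first row is determined along with its first
    column.\<close>
  define M where "M = transpose_mat W * A * W"
  have Mc: "M \<in> carrier_mat (Suc n) (Suc n)"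
    using A Wc by (simp add: M_def)
  have Mt: "transpose_mat M = M"
    using A Wc by (simp add: M_def sym transpose_mult[of _ "Suc n" "Suc n" _ "Suc n"]
        assoc_mult_mat[of _ "Suc n" "Suc n" _ "Suc n" _ "Suc n"])
  have Mx: "M *\<^sub>v x = e \<cdot>\<^sub>v x"
    using A Wc xc orthogonal_group_cancel_vec[OF W xc]
    by (simp add: M_def assoc_mult_mat_vec[of _ "Suc n" "Suc n" _ "Suc n"] AWx mult_mat_vec[of _ "Suc n" "Suc n"])
  obtain E where E: "E \<in> carrier_mat n n" and ME: "M = direct_sum (e \<cdot>\<^sub>m 1\<^sub>m 1) E"
    using fixed_axis_block[OF Mc, of e] Mx Mt unfolding x_def by metis
  have "transpose_mat E = E"
    using Mt E direct_sum_eq_iff[of "transpose_mat (e \<cdot>\<^sub>m 1\<^sub>m 1)" 1 "e \<cdot>\<^sub>m 1\<^sub>m 1" "transpose_mat E" n E]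
    unfolding ME transpose_direct_sum by auto
  have AM: "A = W * M * transpose_mat W"
    using A Wc W by (simp add: M_def assoc_mult_mat[of _ "Suc n" "Suc n" _ "Suc n" _ "Suc n"]
        orthogonal_group_cancel[OF W, of _ "Suc n"] orthogonal_group_iff)
  \<comment> \<open>Similar matrices share their characteristic polynomial. Cancelling the linear
    factor of \<open>e\<close> leaves exactly the product over \<open>fs\<close> that the induction
    hypothesis asks for.\<close>
  have "similar_mat A M"
    by (rule similar_matI[OF _ _ _ AM]) (use W A Mc in \<open>auto simp: orthogonal_group_iff\<close>)
  then have "char_poly A = char_poly M"
    by (rule char_poly_similar)
  also have "\<dots> = char_poly (e \<cdot>\<^sub>m 1\<^sub>m 1) * char_poly E"
    unfolding ME direct_sum_def using E char_poly_four_block_zeros_col[of "e \<cdot>\<^sub>m 1\<^sub>m 1" "0\<^sub>m 1 n" n E] by simp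
  also have "char_poly (e \<cdot>\<^sub>m 1\<^sub>m 1) = [:- e, 1:]"
    by (subst char_poly_upper_triangular[of _ 1]) (auto simp: diag_mat_def)
  finally have "char_poly E = (\<Prod>a\<leftarrow>fs. [:- a, 1:])"
    by (simp add: cp es del: mult_pCons_left)
  from Suc.IH[OF E \<open>transpose_mat E = E\<close> this] obtain V where
    V: "V \<in> carrier (orthogonal_group n)" and EV: "E = V * mat_diag n ((!) fs) * transpose_mat V"
    by blast
  have Vc: "V \<in> carrier_mat n n"
    using V by (simp add: orthogonal_group_iff)
  \<comment> \<open>The matrix diagonalizing \<open>E\<close> is extended by the identity on the
    axis already split off.\<close>
  define S where "S = direct_sum (1\<^sub>m 1) V"
  have S: "S \<in> carrier (orthogonal_group (Suc n))"
    using direct_sum_orthogonal_iff[of "1\<^sub>m 1" 1 V n] V Vc by (simp add: S_def)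
  have Sc: "S \<in> carrier_mat (Suc n) (Suc n)"
    using S by (simp add: orthogonal_group_iff)
  have D: "mat_diag (Suc n) ((!) es) = direct_sum (e \<cdot>\<^sub>m 1\<^sub>m 1) (mat_diag n ((!) fs))"
  proof -
    have "mat_diag (Suc 0) ((!) [e]) = e \<cdot>\<^sub>m 1\<^sub>m 1"
      by (rule eq_matI) (auto simp: mat_diag_def)
    then show ?thesis
      using mat_diag_append[of "[e]" fs] by (simp add: es fs)
  qed
  have "M = S * mat_diag (Suc n) ((!) es) * transpose_mat S"
    using Vc by (simp add: D S_def ME EV transpose_direct_sum direct_sum_mult[where n = 1 and m = n])
  then have "A = (W * S) * mat_diag (Suc n) ((!) es) * transpose_mat (W * S)"
    using conjugate_conjugate[OF Wc Sc, of "mat_diag (Suc n) ((!) es)"] by (simp add: AM)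
  then show ?case
    using orthogonal_group_mult[OF W S] by blast
qed

section \<open>Stabilizer of a vector\<close>

lemma conjugation_mult:
  assumes W: "W \<in> carrier (orthogonal_group n)"
    and X: "X \<in> carrier_mat n n" and Y: "Y \<in> carrier_mat n n"
  shows "transpose_mat W * X * W * (transpose_mat W * Y * W) = transpose_mat W * (X * Y) * W"
proof -
  have Wc: "W \<in> carrier_mat n n" "transpose_mat W \<in> carrier_mat n n"
    using W by (simp_all add: orthogonal_group_iff)
  have "transpose_mat W * X * W * (transpose_mat W * Y * W) =
      transpose_mat W * X * (W * (transpose_mat W * (Y * W)))"
    using Wc X Y by (simp add: assoc_mult_mat[of _ n n _ n _ n])
  also have "\<dots> = transpose_mat W * X * (Y * W)"
    using orthogonal_group_cancel(2)[OF W, of "Y * W" n] Wc Y by simp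
  also have "\<dots> = transpose_mat W * (X * Y) * W"
    using Wc X Y by (simp add: assoc_mult_mat[of _ n n _ n _ n])
  finally show ?thesis .
qed

lemma conjugation_cancel:
  assumes W: "W \<in> carrier (orthogonal_group n)" and X: "X \<in> carrier_mat n n"
  shows "W * (transpose_mat W * X * W) * transpose_mat W = X"
proof -
  have Wc: "W \<in> carrier_mat n n" "transpose_mat W \<in> carrier_mat n n"
    using W by (simp_all add: orthogonal_group_iff)
  have "W * (transpose_mat W * X * W) = X * W"
    using Wc X orthogonal_group_cancel(2)[OF W, of "X * W" n] by simp
  then show ?thesis
    using Wc X W by (simp add: orthogonal_group_iff assoc_mult_mat[of _ n n _ n _ n])
qed

lemma conjugation_bij_betw:
  assumes W: "W \<in> carrier (orthogonal_group n)"
  shows "bij_betw (\<lambda>Q. transpose_mat W * Q * W)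
    (carrier (orthogonal_group n)) (carrier (orthogonal_group n))"
proof (rule bij_betw_byWitness[where f' = "\<lambda>Q. W * Q * transpose_mat W"])
  note Wt = orthogonal_group_transpose[OF W]
  show "\<forall>Q\<in>carrier (orthogonal_group n). W * (transpose_mat W * Q * W) * transpose_mat W = Q"
    using conjugation_cancel[OF W] by (simp add: orthogonal_group_iff)
  show "\<forall>Q\<in>carrier (orthogonal_group n). transpose_mat W * (W * Q * transpose_mat W) * W = Q"
    using conjugation_cancel[OF Wt] by (simp add: orthogonal_group_iff)
qed (use orthogonal_group_mult orthogonal_group_transpose W in blast)+

lemma bij_betw_Collect_eqpoll:
  assumes "bij_betw f A B" "\<And>a. a \<in> A \<Longrightarrow> P a \<longleftrightarrow> Q (f a)"
  shows "{a \<in> A. P a} \<approx> {b \<in> B. Q b}"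
  unfolding eqpoll_def
  by (rule exI[of _ f]) (use assms in \<open>auto simp: bij_betw_def inj_on_def\<close>)

text \<open>The zero vector is fixed by every orthogonal matrix. For nonzero \<open>v\<close>,
  conjugation carries the stabilizer of \<open>v\<close> onto that of the first axis vector, whose
  elements are \<open>direct_sum (1\<^sub>m 1) E\<close> with \<open>E\<close> orthogonal of size
  one less.\<close>

lemma vector_stabilizer_eqpoll:
  assumes v: "v \<in> carrier_vec n"
  shows "{Q \<in> carrier (orthogonal_group n). Q *\<^sub>v v = v} \<approx>
    carrier (orthogonal_group (n - (if v \<noteq> 0\<^sub>v n then 1 else 0)))"
proof (cases "v = 0\<^sub>v n")
  case True
  have "Q *\<^sub>v 0\<^sub>v n = 0\<^sub>v n" if "Q \<in> carrier_mat n n" for Q :: "real mat"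
    using that by (intro eq_vecI) auto
  then have "{Q \<in> carrier (orthogonal_group n). Q *\<^sub>v v = v} = carrier (orthogonal_group n)"
    using True by (auto simp: orthogonal_group_iff)
  then show ?thesis
    using True by simp
next
  case False
  \<comment> \<open>A nonzero vector lives in positive dimension, so \<open>n - 1\<close> is a true
    predecessor here and not a truncated difference.\<close>
  then have "n \<noteq> 0"
    using v by (auto intro: eq_vecI)
  then obtain p where n: "n = Suc p"
    using not0_implies_Suc by blast
  define r where "r = sqrt (v \<bullet> v)"
  define x :: "real vec" where "x = unit_vec n 0"
  have x: "x \<in> carrier_vec n"
    by (simp add: x_def)
  have r: "r \<noteq> 0"
    using v False by (simp add: r_def scalar_prod_self_eq_0_iff)
  obtain W where W: "W \<in> carrier (orthogonal_group n)" and Wv: "W *\<^sub>v (r \<cdot>\<^sub>v x) = v"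
    using orthogonal_moves_axis_to[of v p] v unfolding r_def x_def n by blast
  have Wc: "W \<in> carrier_mat n n"
    using W by (simp add: orthogonal_group_iff)
  have iff: "Q *\<^sub>v v = v \<longleftrightarrow> (transpose_mat W * Q * W) *\<^sub>v x = x"
    if Q: "Q \<in> carrier (orthogonal_group n)" for Q
  proof -
    have Qc: "Q \<in> carrier_mat n n"
      using Q by (simp add: orthogonal_group_iff)
    have "Q *\<^sub>v v = v \<longleftrightarrow> Q *\<^sub>v (W *\<^sub>v x) = W *\<^sub>v x"
      unfolding Wv[symmetric] using Qc Wc x r
      by (auto simp: mult_mat_vec[of _ n n] vec_eq_iff)
    also have "\<dots> \<longleftrightarrow> transpose_mat W *\<^sub>v (Q *\<^sub>v (W *\<^sub>v x)) = x"
      using orthogonal_group_cancel_vec[OF W] Qc Wc x by (metis mult_mat_vec_carrier)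
    finally show ?thesis
      using Qc Wc x by (simp add: assoc_mult_mat_vec[of _ n n _ n])
  qed
  have "{Q \<in> carrier (orthogonal_group n). Q *\<^sub>v v = v} \<approx>
      {R \<in> carrier (orthogonal_group n). R *\<^sub>v x = x}"
    using conjugation_bij_betw[OF W] iff by (rule bij_betw_Collect_eqpoll)
  also have "{R \<in> carrier (orthogonal_group n). R *\<^sub>v x = x} =
      direct_sum (1\<^sub>m 1) ` carrier (orthogonal_group p)"
  proof (intro equalityI subsetI)
    fix R assume "R \<in> {R \<in> carrier (orthogonal_group n). R *\<^sub>v x = x}"
    then have R: "R \<in> carrier (orthogonal_group n)" and Rx: "R *\<^sub>v x = x"
      by auto
    \<comment> \<open>The transpose of \<open>R\<close> is its inverse and so fixes \<open>x\<close>
      as well. This supplies the row condition for splitting off the axis.\<close>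
    have "transpose_mat R *\<^sub>v x = x"
      using orthogonal_group_cancel_vec(1)[OF R x] Rx by simp
    moreover have "R \<in> carrier_mat (Suc p) (Suc p)"
      using R by (simp add: orthogonal_group_iff n)
    moreover have "1 \<cdot>\<^sub>m 1\<^sub>m 1 = (1\<^sub>m 1 :: real mat)"
      by (rule eq_matI) auto
    ultimately obtain E where E: "E \<in> carrier_mat p p" "R = direct_sum (1\<^sub>m 1) E"
      using fixed_axis_block[of R p 1] Rx unfolding x_def n one_smult_vec by metis
    then show "R \<in> direct_sum (1\<^sub>m 1) ` carrier (orthogonal_group p)"
      using R direct_sum_orthogonal_iff[of "1\<^sub>m 1" 1 E p] by (auto simp: n)
  next
    fix R assume "R \<in> direct_sum (1\<^sub>m 1) ` carrier (orthogonal_group p)"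
    then obtain E where E: "E \<in> carrier (orthogonal_group p)" "R = direct_sum (1\<^sub>m 1) E"
      by blast
    then have Ec: "E \<in> carrier_mat p p"
      by (simp add: orthogonal_group_iff)
    have x_split: "x = unit_vec 1 0 @\<^sub>v 0\<^sub>v p"
      by (rule eq_vecI) (auto simp: x_def n)
    have "E *\<^sub>v 0\<^sub>v p = 0\<^sub>v p"
      using Ec by (intro eq_vecI) auto
    then have "R *\<^sub>v x = x"
      using Ec unfolding x_split E(2) by (subst direct_sum_mult_vec[where n = 1 and m = p]) auto
    then show "R \<in> {R \<in> carrier (orthogonal_group n). R *\<^sub>v x = x}"
      using E Ec direct_sum_orthogonal_iff[of "1\<^sub>m 1" 1 E p] by (simp add: n)
  qed
  also have "\<dots> \<approx> carrier (orthogonal_group p)"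
    by (intro inj_on_image_eqpoll_self inj_onI)
      (simp add: orthogonal_group_iff direct_sum_eq_iff[of _ 1 _ _ p])
  finally show ?thesis
    using False by (simp add: n)
qed

section \<open>Orthogonal matrices commuting with a block scalar matrix\<close>

text \<open>The list form connects two views of the spectrum: the linear factors of the
  characteristic polynomial and the diagonal of the block scalar matrix.\<close>

definition spectrum_list :: "nat \<Rightarrow> (nat \<Rightarrow> real) \<Rightarrow> (nat \<Rightarrow> nat) \<Rightarrow> real list" where
  "spectrum_list k eig m = concat (map (\<lambda>j. replicate (m j) (eig j)) [0..<k])"

lemma length_spectrum_list: "length (spectrum_list k eig m) = (\<Sum>j<k. m j)"
  by (simp add: spectrum_list_def length_concat o_def sum_list_distinct_conv_sum_set atLeast0LessThan)

lemma set_spectrum_list: "set (spectrum_list k eig m) \<subseteq> eig ` {..<k}"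
  by (auto simp: spectrum_list_def)

text \<open>Block \<open>0\<close> is split off at the front and the other indices are shifted by
  \<open>Suc\<close>, in step with the recursion of \<open>diag_block_mat\<close> on the head of its
  list.\<close>

lemma spectrum_list_Suc:
  "spectrum_list (Suc k) eig m = replicate (m 0) (eig 0) @ spectrum_list k (eig \<circ> Suc) (m \<circ> Suc)"
  by (simp add: spectrum_list_def upt_conv_Cons map_Suc_upt[symmetric] o_def del: upt_Suc)

definition spectrum_mat :: "nat \<Rightarrow> (nat \<Rightarrow> real) \<Rightarrow> (nat \<Rightarrow> nat) \<Rightarrow> real mat" where
  "spectrum_mat k eig m = mat_diag (\<Sum>j<k. m j) ((!) (spectrum_list k eig m))"

lemma spectrum_mat_carrier: "spectrum_mat k eig m \<in> carrier_mat (\<Sum>j<k. m j) (\<Sum>j<k. m j)"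
  by (simp add: spectrum_mat_def)

lemma spectrum_mat_Suc:
  "spectrum_mat (Suc k) eig m =
    direct_sum (eig 0 \<cdot>\<^sub>m 1\<^sub>m (m 0)) (spectrum_mat k (eig \<circ> Suc) (m \<circ> Suc))"
proof -
  have "mat_diag (m 0) ((!) (replicate (m 0) (eig 0))) = eig 0 \<cdot>\<^sub>m 1\<^sub>m (m 0)"
    by (rule eq_matI) (auto simp: mat_diag_def)
  then show ?thesis
    using mat_diag_append[of "replicate (m 0) (eig 0)" "spectrum_list k (eig \<circ> Suc) (m \<circ> Suc)",
        folded spectrum_list_Suc]
    by (simp add: spectrum_mat_def length_spectrum_list o_def)
qed

lemma diag_block_mat_eq_spectrum_mat:
  "diag_block_mat (map (\<lambda>j. eig j \<cdot>\<^sub>m 1\<^sub>m (m j)) [0..<k]) = spectrum_mat k eig m"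
proof (induction k arbitrary: eig m)
  case 0
  then show ?case
    by (auto simp: spectrum_mat_def mat_diag_def)
next
  case (Suc k)
  show ?case
    using Suc.IH[of "eig \<circ> Suc" "m \<circ> Suc"]
    by (simp add: spectrum_mat_Suc direct_sum_def upt_conv_Cons map_Suc_upt[symmetric] o_def Let_def
        del: upt_Suc)
qed

section \<open>Cutting vectors into blocks\<close>

lemma block_vec_Suc: "block_vec (Suc k) v = v 0 @\<^sub>v block_vec k (v \<circ> Suc)"
proof -
  have "vec_of_list (list_of_vec a @ bs) = a @\<^sub>v vec_of_list bs" for a :: "'a vec" and bs
    by (rule eq_vecI) (auto simp: vec_of_list_index nth_append list_of_vec_index)
  then show ?thesis
    by (simp add: block_vec_def upt_conv_Cons map_Suc_upt[symmetric] o_def del: upt_Suc)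
qed

lemma block_vec_carrier:
  "(\<And>j. j < k \<Longrightarrow> v j \<in> carrier_vec (m j)) \<Longrightarrow> block_vec k v \<in> carrier_vec (\<Sum>j<k. m j)"
proof (induction k arbitrary: v m)
  case 0
  show ?case
    by (rule carrier_vecI) (simp add: block_vec_def)
next
  case (Suc k)
  have "block_vec k (v \<circ> Suc) \<in> carrier_vec (\<Sum>j<k. (m \<circ> Suc) j)"
    by (rule Suc.IH) (simp add: Suc.prems)
  then show ?case
    using Suc.prems[of 0]
    by (simp add: block_vec_Suc sum.lessThan_Suc_shift del: sum.lessThan_Suc)
qed

text \<open>The first \<open>m 0\<close> coordinates are cut off and the rest is split recursively.
  This turns the coordinates of \<open>\<mu>\<close> in an eigenbasis into blocks.\<close>

lemma block_vec_exists:
  "w \<in> carrier_vec (\<Sum>j<k. m j) \<Longrightarrow> \<exists>v. (\<forall>j<k. v j \<in> carrier_vec (m j)) \<and> w = block_vec k v"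
proof (induction k arbitrary: w m)
  case 0
  then show ?case
    by (auto simp: block_vec_def)
next
  case (Suc k)
  let ?N = "\<Sum>j<k. m (Suc j)"
  have w: "w \<in> carrier_vec (m 0 + ?N)"
    using Suc.prems by (simp add: sum.lessThan_Suc_shift del: sum.lessThan_Suc)
  obtain v where v: "\<forall>j<k. v j \<in> carrier_vec (m (Suc j))" "vec_last w ?N = block_vec k v"
    using Suc.IH[of "vec_last w ?N" "m \<circ> Suc"] by auto
  define u where "u = case_nat (vec_first w (m 0)) v"
  have "u \<circ> Suc = v"
    by (auto simp: u_def)
  then have "w = block_vec (Suc k) u"
    using w v(2) by (simp add: block_vec_Suc u_def flip: v(2))
  moreover have "\<forall>j<Suc k. u j \<in> carrier_vec (m j)"
    using v(1) by (auto simp: u_def split: nat.split)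
  ultimately show ?case
    by blast
qed

section \<open>Block structure forced by commutation\<close>

lemma commutes_imp_direct_sum:
  fixes R :: "'a :: field mat"
  assumes R: "R \<in> carrier_mat (n + m) (n + m)"
    and comm: "R * direct_sum (e \<cdot>\<^sub>m 1\<^sub>m n) (mat_diag m f) = direct_sum (e \<cdot>\<^sub>m 1\<^sub>m n) (mat_diag m f) * R"
    and ne: "\<And>i. i < m \<Longrightarrow> f i \<noteq> e"
  obtains A E where "A \<in> carrier_mat n n" "E \<in> carrier_mat m m" "R = direct_sum A E"
proof -
  obtain A B C E where split: "split_block R n n = (A, B, C, E)"
    by (metis prod_cases4)
  have c: "A \<in> carrier_mat n n" "B \<in> carrier_mat n m" "C \<in> carrier_mat m n" "E \<in> carrier_mat m m"
    and RE: "R = four_block_mat A B C E"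
    using split_block[OF split] R by auto
  let ?D = "mat_diag m f"
  have D: "?D \<in> carrier_mat m m"
    by simp
  note Dd = carrier_matD[OF D]
  have "four_block_mat (A * (e \<cdot>\<^sub>m 1\<^sub>m n)) (B * ?D) (C * (e \<cdot>\<^sub>m 1\<^sub>m n)) (E * ?D) =
      R * direct_sum (e \<cdot>\<^sub>m 1\<^sub>m n) ?D"
    unfolding RE direct_sum_def using c D by (subst mult_four_block_mat) (auto simp: Dd)
  also have "\<dots> = four_block_mat ((e \<cdot>\<^sub>m 1\<^sub>m n) * A) ((e \<cdot>\<^sub>m 1\<^sub>m n) * B) (?D * C) (?D * E)"
    unfolding comm unfolding RE direct_sum_def using c D by (subst mult_four_block_mat) (auto simp: Dd)
  finally have eq: "four_block_mat (A * (e \<cdot>\<^sub>m 1\<^sub>m n)) (B * ?D) (C * (e \<cdot>\<^sub>m 1\<^sub>m n)) (E * ?D) =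
      four_block_mat ((e \<cdot>\<^sub>m 1\<^sub>m n) * A) ((e \<cdot>\<^sub>m 1\<^sub>m n) * B) (?D * C) (?D * E)" .
  have e: "e \<cdot>\<^sub>m 1\<^sub>m n \<in> carrier_mat n n"
    by simp
  \<comment> \<open>Only the off-diagonal blocks matter. Entrywise, these equations say that column
    \<open>j\<close> of \<open>B\<close> and row \<open>j\<close> of \<open>C\<close> are scaled by
    \<open>f j\<close> and by \<open>e\<close> with the same result, so they vanish as
    \<open>f j\<close> differs from \<open>e\<close>.\<close>
  have B: "B * ?D = (e \<cdot>\<^sub>m 1\<^sub>m n) * B" and C: "C * (e \<cdot>\<^sub>m 1\<^sub>m n) = ?D * C"
    using eq four_block_eq_iff[OF mult_carrier_mat[OF c(1) e] mult_carrier_mat[OF c(2) D]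
        mult_carrier_mat[OF c(3) e] mult_carrier_mat[OF c(4) D] mult_carrier_mat[OF e c(1)]
        mult_carrier_mat[OF e c(2)] mult_carrier_mat[OF D c(3)] mult_carrier_mat[OF D c(4)]]
    by blast+
  have "B $$ (i, j) = 0" if "i < n" "j < m" for i j
    using arg_cong[OF B, of "\<lambda>X. X $$ (i, j)"] that c ne[of j]
    by (simp add: mat_diag_mult_right[OF c(2)] mult_smult_assoc_mat[of _ n n _ m] mult.commute)
  moreover have "C $$ (i, j) = 0" if "i < m" "j < n" for i j
    using arg_cong[OF C, of "\<lambda>X. X $$ (i, j)"] that c ne[of i]
    by (simp add: mat_diag_mult_left[OF c(3)] mult_smult_distrib[of _ m n _ n])
  ultimately have "B = 0\<^sub>m n m" "C = 0\<^sub>m m n"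
    using c by (auto intro!: eq_matI)
  then have "R = direct_sum A E"
    using c by (simp add: RE direct_sum_def)
  with c that show thesis
    by blast
qed

text \<open>Index \<open>0\<close> is separated rather than the last one, to match the block that
  the induction on the number of eigenvalues splits off.\<close>

lemma PiE_lessThan_Suc_eqpoll:
  "(\<Pi>\<^sub>E j\<in>{..<Suc k}. F j) \<approx> F 0 \<times> (\<Pi>\<^sub>E j\<in>{..<k}. F (Suc j))"
  unfolding eqpoll_def
proof
  \<comment> \<open>Restricting to the index range makes the values outside it
    \<open>undefined\<close>, as membership in \<open>PiE\<close> demands.\<close>
  let ?f = "\<lambda>f. (f 0, \<lambda>j\<in>{..<k}. f (Suc j))"
  let ?g = "\<lambda>(a, g). \<lambda>j\<in>{..<Suc k}. case_nat a g j"
  show "bij_betw ?f (\<Pi>\<^sub>E j\<in>{..<Suc k}. F j) (F 0 \<times> (\<Pi>\<^sub>E j\<in>{..<k}. F (Suc j)))"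
  proof (rule bij_betw_byWitness[where f' = ?g])
    show "\<forall>f\<in>\<Pi>\<^sub>E j\<in>{..<Suc k}. F j. ?g (?f f) = f"
    proof (intro ballI ext)
      fix f j assume "f \<in> (\<Pi>\<^sub>E j\<in>{..<Suc k}. F j)"
      then show "?g (?f f) j = f j"
        using PiE_arb[of f "{..<Suc k}" F j] by (cases j) auto
    qed
    show "\<forall>p\<in>F 0 \<times> (\<Pi>\<^sub>E j\<in>{..<k}. F (Suc j)). ?f (?g p) = p"
      by (auto simp: fun_eq_iff PiE_iff extensional_def)
    show "?f ` (\<Pi>\<^sub>E j\<in>{..<Suc k}. F j) \<subseteq> F 0 \<times> (\<Pi>\<^sub>E j\<in>{..<k}. F (Suc j))"
    proof (rule image_subsetI)
      fix f assume "f \<in> (\<Pi>\<^sub>E j\<in>{..<Suc k}. F j)"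
      then have "f j \<in> F j" if "j < Suc k" for j
        using that by (simp add: PiE_mem)
      then show "?f f \<in> F 0 \<times> (\<Pi>\<^sub>E j\<in>{..<k}. F (Suc j))"
        by simp
    qed
    show "?g ` (F 0 \<times> (\<Pi>\<^sub>E j\<in>{..<k}. F (Suc j))) \<subseteq> (\<Pi>\<^sub>E j\<in>{..<Suc k}. F j)"
    proof (rule image_subsetI)
      fix p assume "p \<in> F 0 \<times> (\<Pi>\<^sub>E j\<in>{..<k}. F (Suc j))"
      then obtain a g where "p = (a, g)" "a \<in> F 0" "\<And>j. j < k \<Longrightarrow> g j \<in> F (Suc j)"
        by (auto simp: PiE_mem)
      then show "?g p \<in> (\<Pi>\<^sub>E j\<in>{..<Suc k}. F j)"
        by (auto split: nat.split)
    qed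
  qed
qed

lemma orthogonal_group_0: "carrier (orthogonal_group 0) = {1\<^sub>m 0}"
  by (auto simp: orthogonal_group_iff intro!: eq_matI)

text \<open>Commutation splits off the block of \<open>eig 0\<close>, since the other eigenvalues
  differ from it. That block only has to fix \<open>v 0\<close>, a stabilizer already computed. The
  rest satisfies the same conditions with shifted indices, so induction on \<open>k\<close>
  applies.\<close>

lemma commutant_stabilizer_eqpoll:
  assumes "inj_on eig {..<k}" and "\<And>j. j < k \<Longrightarrow> v j \<in> carrier_vec (m j)"
  shows "{R \<in> carrier (orthogonal_group (\<Sum>j<k. m j)).
        R * spectrum_mat k eig m = spectrum_mat k eig m * R \<and> R *\<^sub>v block_vec k v = block_vec k v} \<approx>
    (\<Pi>\<^sub>E j\<in>{..<k}. carrier (orthogonal_group (m j - (if v j \<noteq> 0\<^sub>v (m j) then 1 else 0))))"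
  using assms
proof (induction k arbitrary: eig m v)
  case 0
  have "{R \<in> carrier (orthogonal_group 0). R * spectrum_mat 0 eig m = spectrum_mat 0 eig m * R \<and>
      R *\<^sub>v block_vec 0 v = block_vec 0 v} = {1\<^sub>m 0}"
    using spectrum_mat_carrier[of 0 eig m] block_vec_carrier[of 0 v m]
    by (auto simp: orthogonal_group_0)
  then show ?case
    by (simp add: singleton_eqpoll)
next
  case (Suc k)
  let ?n = "m 0" and ?N = "\<Sum>j<k. m (Suc j)"
  let ?D = "spectrum_mat k (eig \<circ> Suc) (m \<circ> Suc)" and ?b = "block_vec k (v \<circ> Suc)"
  let ?O = "\<lambda>n. carrier (orthogonal_group n)"
  define S where "S = {A \<in> ?O ?n. A *\<^sub>v v 0 = v 0}"
  define T where "T = {E \<in> ?O ?N. E * ?D = ?D * E \<and> E *\<^sub>v ?b = ?b}"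
  have inj: "inj_on (eig \<circ> Suc) {..<k}"
    using Suc.prems(1) by (auto simp: inj_on_def)
  have N: "(\<Sum>j<Suc k. m j) = ?n + ?N"
    by (rule sum.lessThan_Suc_shift)
  have D: "?D \<in> carrier_mat ?N ?N"
    using spectrum_mat_carrier[of k "eig \<circ> Suc" "m \<circ> Suc"] by simp
  have v0: "v 0 \<in> carrier_vec ?n" and b: "?b \<in> carrier_vec ?N"
    using Suc.prems(2) block_vec_carrier[of k "v \<circ> Suc" "m \<circ> Suc"] by auto
  have IH: "T \<approx> (\<Pi>\<^sub>E j\<in>{..<k}. ?O (m (Suc j) - (if v (Suc j) \<noteq> 0\<^sub>v (m (Suc j)) then 1 else 0)))"
    using Suc.IH[OF inj, of "v \<circ> Suc" "m \<circ> Suc"] Suc.prems(2) by (simp add: T_def o_def)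
  have S_carrier: "A \<in> carrier_mat ?n ?n" if "A \<in> S" for A
    using that by (simp add: S_def orthogonal_group_iff)
  have T_carrier: "E \<in> carrier_mat ?N ?N" if "E \<in> T" for E
    using that by (simp add: T_def orthogonal_group_iff)
  \<comment> \<open>The conditions decouple along the two blocks. On the first block commutation is
    automatic, the block of the spectrum being scalar there.\<close>
  have iff: "direct_sum A E \<in> ?O (?n + ?N) \<and>
      direct_sum A E * direct_sum (eig 0 \<cdot>\<^sub>m 1\<^sub>m ?n) ?D = direct_sum (eig 0 \<cdot>\<^sub>m 1\<^sub>m ?n) ?D * direct_sum A E \<and>
      direct_sum A E *\<^sub>v (v 0 @\<^sub>v ?b) = v 0 @\<^sub>v ?b \<longleftrightarrow> A \<in> S \<and> E \<in> T"
    if A: "A \<in> carrier_mat ?n ?n" and E: "E \<in> carrier_mat ?N ?N" for A E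
  proof -
    have 1: "A * (eig 0 \<cdot>\<^sub>m 1\<^sub>m ?n) = eig 0 \<cdot>\<^sub>m 1\<^sub>m ?n * A"
      using A by (simp add: mult_smult_assoc_mat[of _ ?n ?n _ ?n] mult_smult_distrib[of _ ?n ?n _ ?n])
    have "direct_sum A E * direct_sum (eig 0 \<cdot>\<^sub>m 1\<^sub>m ?n) ?D =
        direct_sum (eig 0 \<cdot>\<^sub>m 1\<^sub>m ?n) ?D * direct_sum A E \<longleftrightarrow> E * ?D = ?D * E"
      using A E D mult_carrier_mat[OF E D] mult_carrier_mat[OF D E]
        mult_carrier_mat[of "eig 0 \<cdot>\<^sub>m 1\<^sub>m ?n" ?n ?n A ?n]
      by (simp add: 1 direct_sum_mult[where n = ?n and m = ?N] direct_sum_eq_iff[where n = ?n and m = ?N])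
    moreover have "direct_sum A E *\<^sub>v (v 0 @\<^sub>v ?b) = v 0 @\<^sub>v ?b \<longleftrightarrow> A *\<^sub>v v 0 = v 0 \<and> E *\<^sub>v ?b = ?b"
      using A E v0 b by (simp add: direct_sum_mult_vec[where n = ?n and m = ?N] append_vec_eq[of _ ?n])
    ultimately show ?thesis
      using direct_sum_orthogonal_iff[OF A E] by (auto simp: S_def T_def)
  qed
  have "{R \<in> ?O (?n + ?N). R * direct_sum (eig 0 \<cdot>\<^sub>m 1\<^sub>m ?n) ?D = direct_sum (eig 0 \<cdot>\<^sub>m 1\<^sub>m ?n) ?D * R \<and>
      R *\<^sub>v (v 0 @\<^sub>v ?b) = v 0 @\<^sub>v ?b} = (\<lambda>(A, E). direct_sum A E) ` (S \<times> T)" (is "?L = ?R")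
  proof (intro equalityI subsetI)
    fix R assume R: "R \<in> ?L"
    then have Rc: "R \<in> carrier_mat (?n + ?N) (?n + ?N)"
      by (simp add: orthogonal_group_iff)
    \<comment> \<open>Every remaining diagonal entry is some \<open>eig (Suc j)\<close>, which
      injectivity of \<open>eig\<close> separates from \<open>eig 0\<close>.\<close>
    have "spectrum_list k (eig \<circ> Suc) (m \<circ> Suc) ! i \<noteq> eig 0" if i: "i < ?N" for i
    proof -
      have "spectrum_list k (eig \<circ> Suc) (m \<circ> Suc) ! i \<in> (eig \<circ> Suc) ` {..<k}"
        using i set_spectrum_list[of k "eig \<circ> Suc" "m \<circ> Suc"] nth_mem
        by (fastforce simp: length_spectrum_list)
      then obtain j where "j < k" "spectrum_list k (eig \<circ> Suc) (m \<circ> Suc) ! i = eig (Suc j)"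
        by auto
      then show ?thesis
        using inj_onD[OF Suc.prems(1), of "Suc j" 0] by auto
    qed
    then obtain A E where AE: "A \<in> carrier_mat ?n ?n" "E \<in> carrier_mat ?N ?N" "R = direct_sum A E"
      using commutes_imp_direct_sum[OF Rc, of "eig 0" "(!) (spectrum_list k (eig \<circ> Suc) (m \<circ> Suc))"] R
      by (auto simp: spectrum_mat_def)
    then show "R \<in> ?R"
      using iff[OF AE(1,2)] R by auto
  next
    fix R assume "R \<in> ?R"
    then show "R \<in> ?L"
      using iff S_carrier T_carrier by auto
  qed
  also have "\<dots> \<approx> S \<times> T"
    by (rule inj_on_image_eqpoll_self)
      (auto simp: inj_on_def direct_sum_eq_iff[where n = ?n and m = ?N] dest!: S_carrier T_carrier)
  also have "\<dots> \<approx> ?O (?n - (if v 0 \<noteq> 0\<^sub>v ?n then 1 else 0)) \<times>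
      (\<Pi>\<^sub>E j\<in>{..<k}. ?O (m (Suc j) - (if v (Suc j) \<noteq> 0\<^sub>v (m (Suc j)) then 1 else 0)))"
    using vector_stabilizer_eqpoll[OF v0] IH unfolding S_def by (rule times_eqpoll_cong)
  also have "\<dots> \<approx> (\<Pi>\<^sub>E j\<in>{..<Suc k}. ?O (m j - (if v j \<noteq> 0\<^sub>v (m j) then 1 else 0)))"
    by (rule eqpoll_sym[OF PiE_lessThan_Suc_eqpoll])
  finally show ?case
    unfolding N spectrum_mat_Suc block_vec_Suc .
qed

section \<open>Stabilizer of a Gaussian\<close>

lemma card_orthogonal_group_1: "card (carrier (orthogonal_group 1)) = 2"
proof -
  have "carrier (orthogonal_group 1) = (\<lambda>c. mat 1 1 (\<lambda>_. c)) ` {1, - 1}"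
  proof (intro equalityI subsetI)
    fix Q assume "Q \<in> carrier (orthogonal_group 1)"
    then have Q: "Q \<in> carrier_mat 1 1" "transpose_mat Q * Q = 1\<^sub>m 1"
      by (auto simp: orthogonal_group_iff)
    have "Q $$ (0, 0) * Q $$ (0, 0) = 1"
      using arg_cong[OF Q(2), of "\<lambda>X. X $$ (0, 0)"] Q(1)
      by (simp add: scalar_prod_def)
    then have "Q $$ (0, 0) \<in> {1, - 1}"
      by (simp add: square_eq_1_iff)
    moreover have "Q = mat 1 1 (\<lambda>_. Q $$ (0, 0))"
      using Q by (intro eq_matI) auto
    ultimately show "Q \<in> (\<lambda>c. mat 1 1 (\<lambda>_. c)) ` {1, - 1}"
      by blast
  next
    fix Q :: "real mat" assume "Q \<in> (\<lambda>c. mat 1 1 (\<lambda>_. c)) ` {1, - 1}"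
    then show "Q \<in> carrier (orthogonal_group 1)"
      by (auto simp: orthogonal_group_iff scalar_prod_def intro!: eq_matI)
  qed
  moreover have "mat 1 1 (\<lambda>_. 1) \<noteq> (mat 1 1 (\<lambda>_. - 1) :: real mat)"
  proof
    assume "mat 1 1 (\<lambda>_. 1) = (mat 1 1 (\<lambda>_. - 1) :: real mat)"
    then have "mat 1 1 (\<lambda>_. 1) $$ (0, 0) = (mat 1 1 (\<lambda>_. - 1) :: real mat) $$ (0, 0)"
      by (rule arg_cong)
    then show False
      by simp
  qed
  ultimately show ?thesis
    by simp
qed

text \<open>Both sets are finite, so it suffices to count: a factor of size one contributes two
  elements, a factor of size zero only the empty matrix. The predicate \<open>P\<close> stands for a
  nonzero block of the mean.\<close>

lemma orthogonal_product_eqpoll_Z2: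
  fixes k :: nat
  assumes "\<And>j. j < k \<Longrightarrow> m j = 1"
  shows "(\<Pi>\<^sub>E j\<in>{..<k}. carrier (orthogonal_group (m j - (if P j then 1 else 0)))) \<approx>
    carrier (product_group {..<card {j. j < k \<and> \<not> P j}} (\<lambda>_. integer_mod_group 2))"
proof -
  let ?O = "\<lambda>j. carrier (orthogonal_group (m j - (if P j then 1 else 0)))"
  let ?Z = "\<lambda>_ :: nat. carrier (integer_mod_group 2)"
  have card_O: "card (?O j) = (if P j then 1 else 2)" if "j < k" for j
    using assms[OF that] card_orthogonal_group_1 by (simp add: orthogonal_group_0)
  have card_Z: "card (?Z j) = 2" for j
    by (simp add: carrier_integer_mod_group)
  have "finite (Pi\<^sub>E {..<k} ?O)"
  proof (rule finite_PiE)
    \<comment> \<open>An infinite set has \<open>card\<close> equal to \<open>0\<close>, so positive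
      cardinality already yields finiteness.\<close>
    show "finite (?O j)" if "j \<in> {..<k}" for j
      using card_O[of j] that by (intro card_ge_0_finite) simp
  qed simp
  moreover have "finite (Pi\<^sub>E {..<card {j. j < k \<and> \<not> P j}} ?Z)"
    by (rule finite_PiE) (simp_all add: carrier_integer_mod_group)
  moreover have "card (Pi\<^sub>E {..<k} ?O) = 2 ^ card {j. j < k \<and> \<not> P j}"
  proof -
    have "card (Pi\<^sub>E {..<k} ?O) = (\<Prod>j<k. if P j then 1 else 2)"
      unfolding card_PiE[OF finite_lessThan] by (rule prod.cong) (simp_all add: card_O)
    also have "\<dots> = (\<Prod>j | j < k \<and> \<not> P j. 2)"
      by (intro prod.mono_neutral_cong_right) auto
    finally show ?thesis
      by simp
  qed
  moreover have "card (Pi\<^sub>E {..<card {j. j < k \<and> \<not> P j}} ?Z) = 2 ^ card {j. j < k \<and> \<not> P j}"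
    unfolding card_PiE[OF finite_lessThan] card_Z by simp
  ultimately show ?thesis
    by (simp add: eqpoll_iff_card)
qed

section \<open>Multiplicities as orders of roots\<close>

lemma order_linear_factors:
  fixes x :: "'a :: idom"
  shows "Polynomial.order x (\<Prod>a\<leftarrow>es. [:- a, 1:]) = count (mset es) x"
proof (induction es)
  case (Cons a es)
  have "(\<Prod>a\<leftarrow>es. [:- a, 1:]) \<noteq> 0"
    by (auto simp: prod_list_zero_iff)
  moreover have "Polynomial.order x [:- a, 1:] = (if x = a then 1 else 0)"
    using order_power_n_n[of a 1] by (auto intro!: order_0I)
  ultimately show ?case
    using Cons.IH by (simp add: order_mult del: mult_pCons_left)
qed simp

text \<open>The roots found by splitting and the prescribed list have equal multiplicity at every
  point: at eigenvalues by the choice of \<open>m\<close>, elsewhere because both are zero. The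
  product depends only on the multiset of roots.\<close>

lemma char_poly_eq_spectrum_list:
  fixes A :: "real mat"
  assumes A: "A \<in> carrier_mat d d" and sym: "transpose_mat A = A"
    and eig: "bij_betw eig {..<k} {x. eigenvalue A x}"
    and m: "\<And>j. j < k \<Longrightarrow> m j = Polynomial.order (eig j) (char_poly A)"
  shows "char_poly A = (\<Prod>a\<leftarrow>spectrum_list k eig m. [:- a, 1:])"
proof -
  obtain es where es: "char_poly A = (\<Prod>a\<leftarrow>es. [:- a, 1:])"
    using symmetric_char_poly_splits[OF A sym] .
  have inj: "inj_on eig {..<k}" and im: "eig ` {..<k} = {x. eigenvalue A x}"
    using eig by (auto simp: bij_betw_def)
  have "count (mset es) x = count (mset (spectrum_list k eig m)) x" for x
  proof -
    have "count (mset (spectrum_list k eig m)) x = (\<Sum>j<k. if eig j = x then m j else 0)"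
      unfolding spectrum_list_def
      by (induction k) auto
    also have "\<dots> = Polynomial.order x (char_poly A)"
    proof (cases "x \<in> eig ` {..<k}")
      case True
      then obtain i where i: "i < k" "x = eig i"
        by auto
      have "(\<Sum>j<k. if eig j = x then m j else 0) = (\<Sum>j<k. if j = i then m j else 0)"
        using i inj by (intro sum.cong) (auto dest: inj_onD)
      then show ?thesis
        using i m by simp
    next
      case False
      then have "poly (char_poly A) x \<noteq> 0"
        using im eigenvalue_root_char_poly[OF A] by auto
      then have "Polynomial.order x (char_poly A) = 0"
        by (rule order_0I)
      moreover have "(\<Sum>j<k. if eig j = x then m j else 0) = 0"
        using False by (intro sum.neutral) auto
      ultimately show ?thesis
        by simp
    qed
    finally show ?thesis
      by (simp add: es order_linear_factors)
  qed
  then have "mset es = mset (spectrum_list k eig m)"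
    by (rule multiset_eqI)
  then show ?thesis
    unfolding es by (metis mset_map prod_mset_prod_list)
qed

text \<open>Existence of eigen-coordinates keeps the claim about all of them from being vacuous; the
  claim then holds for every choice of eigenbasis. Distinctness of all eigenvalues is expressed by
  every multiplicity being one.\<close>

theorem proposition4p2:
  fixes d k :: nat and \<mu> :: "real vec" and \<Sigma> :: "real mat"
    and eig :: "nat \<Rightarrow> real" and m :: "nat \<Rightarrow> nat"
  assumes "(\<mu>, \<Sigma>) \<in> gaussians d"
    and "bij_betw eig {..<k} {x. eigenvalue \<Sigma> x}"
    and "\<And>j. j < k \<Longrightarrow> m j = Polynomial.order (eig j) (char_poly \<Sigma>)"
  shows "(\<exists>U \<mu>s. eigen_coordinates d k eig m (\<mu>, \<Sigma>) U \<mu>s) \<and>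
    (\<forall>U \<mu>s. eigen_coordinates d k eig m (\<mu>, \<Sigma>) U \<mu>s \<longrightarrow>
      (\<exists>f. bij_betw f (stabilizer (orthogonal_group d) gaussian_action (\<mu>, \<Sigma>))
         (carrier (product_group {..<k}
            (\<lambda>j. orthogonal_group (m j - (if \<mu>s j \<noteq> 0\<^sub>v (m j) then 1 else 0)))))) \<and>
      ((\<forall>j<k. m j = 1) \<longrightarrow>
        (\<exists>f. bij_betw f (stabilizer (orthogonal_group d) gaussian_action (\<mu>, \<Sigma>))
           (carrier (product_group {..<card {j. j < k \<and> \<mu>s j = 0\<^sub>v (m j)}}
              (\<lambda>_. integer_mod_group 2))))))"
proof -
  have \<mu>: "\<mu> \<in> carrier_vec d" and \<Sigma>: "\<Sigma> \<in> carrier_mat d d" "transpose_mat \<Sigma> = \<Sigma>"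
    using assms(1) by (auto simp: gaussians_def)
  have inj: "inj_on eig {..<k}"
    using assms(2) by (simp add: bij_betw_def)
  have cp: "char_poly \<Sigma> = (\<Prod>a\<leftarrow>spectrum_list k eig m. [:- a, 1:])"
    using \<Sigma> assms(2,3) by (rule char_poly_eq_spectrum_list)
  \<comment> \<open>Comparison of degrees in the factorization of the characteristic
    polynomial.\<close>
  have d: "d = (\<Sum>j<k. m j)"
    using degree_monic_char_poly[OF \<Sigma>(1)] degree_linear_factors[of uminus "spectrum_list k eig m"]
    by (simp add: cp length_spectrum_list)
  have D: "spectrum_mat k eig m \<in> carrier_mat d d"
    unfolding d by (rule spectrum_mat_carrier)
  have "\<exists>U \<mu>s. eigen_coordinates d k eig m (\<mu>, \<Sigma>) U \<mu>s"
  proof -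
    \<comment> \<open>Diagonalization accepts the roots in any order. Feeding it the list grouped by
      eigenvalue yields the block scalar form directly.\<close>
    obtain U where U: "U \<in> carrier (orthogonal_group d)"
      and \<Sigma>U: "\<Sigma> = U * spectrum_mat k eig m * transpose_mat U"
      using symmetric_orthogonal_diagonalization[OF \<Sigma> cp] unfolding spectrum_mat_def d by blast
    have "transpose_mat U *\<^sub>v \<mu> \<in> carrier_vec (\<Sum>j<k. m j)"
      unfolding d[symmetric] using U \<mu>
      by (intro mult_mat_vec_carrier[of _ _ d]) (simp_all add: orthogonal_group_iff)
    then obtain \<mu>s where \<mu>s: "\<forall>j<k. \<mu>s j \<in> carrier_vec (m j)"
        "transpose_mat U *\<^sub>v \<mu> = block_vec k \<mu>s"
      using block_vec_exists by blast
    have "\<mu> = U *\<^sub>v block_vec k \<mu>s"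
      using orthogonal_group_cancel_vec(2)[OF U \<mu>] \<mu>s(2) by simp
    then have "eigen_coordinates d k eig m (\<mu>, \<Sigma>) U \<mu>s"
      using U \<Sigma>U \<mu>s by (simp add: eigen_coordinates_def diag_block_mat_eq_spectrum_mat)
    then show ?thesis
      by blast
  qed
  moreover have "stabilizer (orthogonal_group d) gaussian_action (\<mu>, \<Sigma>) \<approx>
      (\<Pi>\<^sub>E j\<in>{..<k}. carrier (orthogonal_group (m j - (if \<mu>s j \<noteq> 0\<^sub>v (m j) then 1 else 0))))"
    if coords: "eigen_coordinates d k eig m (\<mu>, \<Sigma>) U \<mu>s" for U \<mu>s
  proof -
    let ?D = "spectrum_mat k eig m" and ?b = "block_vec k \<mu>s"
    let ?c = "\<lambda>Q. transpose_mat U * Q * U"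
    have U: "U \<in> carrier (orthogonal_group d)" and \<Sigma>U: "\<Sigma> = U * ?D * transpose_mat U"
      and \<mu>s: "\<And>j. j < k \<Longrightarrow> \<mu>s j \<in> carrier_vec (m j)" and \<mu>U: "\<mu> = U *\<^sub>v ?b"
      using coords by (auto simp: eigen_coordinates_def diag_block_mat_eq_spectrum_mat)
    have Uc: "U \<in> carrier_mat d d" "transpose_mat U \<in> carrier_mat d d"
      using U by (simp_all add: orthogonal_group_iff)
    have b: "?b \<in> carrier_vec d"
      unfolding d using \<mu>s by (rule block_vec_carrier)
    have c\<Sigma>: "?c \<Sigma> = ?D"
      using conjugation_cancel[OF orthogonal_group_transpose[OF U] D] by (simp add: \<Sigma>U)
    \<comment> \<open>Conjugation by \<open>U\<close> moves both conditions into eigen-coordinates,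
      where \<open>\<Sigma>\<close> becomes \<open>?D\<close> and \<open>\<mu>\<close> becomes
      \<open>?b\<close>.\<close>
    have iff: "gaussian_action Q (\<mu>, \<Sigma>) = (\<mu>, \<Sigma>) \<longleftrightarrow> ?c Q * ?D = ?D * ?c Q \<and> ?c Q *\<^sub>v ?b = ?b"
      if Q: "Q \<in> carrier (orthogonal_group d)" for Q
    proof -
      have Qc: "Q \<in> carrier_mat d d" "transpose_mat Q \<in> carrier_mat d d"
        using Q by (simp_all add: orthogonal_group_iff)
      note prods = mult_carrier_mat[OF Qc(1) \<Sigma>(1)] mult_carrier_mat[OF \<Sigma>(1) Qc(1)]
      have "Q * \<Sigma> * transpose_mat Q = \<Sigma> \<longleftrightarrow> Q * \<Sigma> = \<Sigma> * Q"
      proof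
        assume "Q * \<Sigma> * transpose_mat Q = \<Sigma>"
        then have "\<Sigma> * Q = Q * \<Sigma> * (transpose_mat Q * Q)"
          using assoc_mult_mat[OF prods(1) Qc(2,1)] by simp
        then show "Q * \<Sigma> = \<Sigma> * Q"
          using Q right_mult_one_mat[OF prods(1)] by (simp add: orthogonal_group_iff)
      next
        assume "Q * \<Sigma> = \<Sigma> * Q"
        then have "Q * \<Sigma> * transpose_mat Q = \<Sigma> * (Q * transpose_mat Q)"
          using assoc_mult_mat[OF \<Sigma>(1) Qc] by simp
        then show "Q * \<Sigma> * transpose_mat Q = \<Sigma>"
          using Q \<Sigma> by (simp add: orthogonal_group_iff)
      qed
      \<comment> \<open>Conjugation by an orthogonal matrix can be undone, hence is injective. Being
        multiplicative as well, it turns commutation with \<open>\<Sigma>\<close> into commutation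
        with \<open>?D\<close>.\<close>
      also have "\<dots> \<longleftrightarrow> ?c (Q * \<Sigma>) = ?c (\<Sigma> * Q)"
        using conjugation_cancel[OF U prods(1)] conjugation_cancel[OF U prods(2)] by metis
      also have "\<dots> \<longleftrightarrow> ?c Q * ?D = ?D * ?c Q"
        using conjugation_mult[OF U Qc(1) \<Sigma>(1)] conjugation_mult[OF U \<Sigma>(1) Qc(1)]
        unfolding c\<Sigma> by simp
      finally have 1: "Q * \<Sigma> * transpose_mat Q = \<Sigma> \<longleftrightarrow> ?c Q * ?D = ?D * ?c Q" .
      have "Q *\<^sub>v \<mu> = \<mu> \<longleftrightarrow> transpose_mat U *\<^sub>v (Q *\<^sub>v (U *\<^sub>v ?b)) = ?b"
        unfolding \<mu>U using orthogonal_group_cancel_vec[OF U] Qc Uc b by (metis mult_mat_vec_carrier)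
      also have "\<dots> \<longleftrightarrow> ?c Q *\<^sub>v ?b = ?b"
        using Qc Uc b by (simp add: assoc_mult_mat_vec[of _ d d _ d])
      finally show ?thesis
        using 1 by (auto simp: gaussian_action_def)
    qed
    have "stabilizer (orthogonal_group d) gaussian_action (\<mu>, \<Sigma>) \<approx>
        {R \<in> carrier (orthogonal_group d). R * ?D = ?D * R \<and> R *\<^sub>v ?b = ?b}"
      unfolding stabilizer_def using conjugation_bij_betw[OF U] iff by (rule bij_betw_Collect_eqpoll)
    also have "\<dots> \<approx> (\<Pi>\<^sub>E j\<in>{..<k}. carrier (orthogonal_group (m j - (if \<mu>s j \<noteq> 0\<^sub>v (m j) then 1 else 0))))"
      unfolding d using inj \<mu>s by (rule commutant_stabilizer_eqpoll)
    finally show ?thesis .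
  qed
  \<comment> \<open>The carrier of a product group is a \<open>PiE\<close> set, and existence of a
    bijection is equipollence. The case of simple eigenvalues follows by transitivity.\<close>
  ultimately show ?thesis
    using orthogonal_product_eqpoll_Z2[of k m "\<lambda>j. \<mu>s j \<noteq> 0\<^sub>v (m j)" for \<mu>s]
    unfolding carrier_product_group eqpoll_def[symmetric]
    by (auto intro: eqpoll_trans)
qed

end
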